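(* Let $(\Omega,\mu)$ be a $\sigma$-finite measure space (with $\mu$ a positive measure) with infinite measure, $\mu(\Omega)=\infty$, and let $\mathcal{H}$ be an infinite dimensional separable complex Hilbert space. Then there exists a continuous Parseval frame $F:\Omega\to\mathcal{H}$ with respect to $(\Omega,\mu)$.
   Context: Let $\mathcal{H}$ be a complex Hilbert space and $(\Omega,\mu)$ a measure space with positive measure $\mu$. A mapping $F:\Omega\to\mathcal{H}$ is a continuous frame with respect to $(\Omega,\mu)$ if (1) $F$ is weakly measurable, i.e. for every $f\in\mathcal{H}$ the function $\omega\mapsto\langle f,F(\omega)\rangle$ is measurable on $\Omega$; and (2) there exist constants $A,B>0$ such that $A\|f\|^2\le\int_\Omega|\langle f,F(\omega)\rangle|^2\,d\mu(\omega)\le B\|f\|^2$ for all $f\in\mathcal{H}$. It is a continuous Parseval frame if this holds with $A=B=1$. *)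

theory Defs
  imports "HOL-Analysis.Analysis"
begin

text \<open>
  Complex inner product spaces, built on top of \<^class>\<open>real_normed_vector\<close> so that norm, metric and
  topology are the library's. The inner product is linear in its first and conjugate-linear in its
  second argument.
\<close>

class complex_inner = real_normed_vector +
  fixes scaleC :: "complex \<Rightarrow> 'a \<Rightarrow> 'a"  (infixr "*\<^sub>C" 75)
    and cinner :: "'a \<Rightarrow> 'a \<Rightarrow> complex"
  assumes scaleC_add_right: "c *\<^sub>C (x + y) = c *\<^sub>C x + c *\<^sub>C y"
    and scaleC_add_left: "(c + d) *\<^sub>C x = c *\<^sub>C x + d *\<^sub>C x"
    and scaleC_scaleC: "c *\<^sub>C d *\<^sub>C x = (c * d) *\<^sub>C x"
    and scaleC_one: "1 *\<^sub>C x = x"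
    and scaleC_of_real: "complex_of_real r *\<^sub>C x = r *\<^sub>R x"
    and cinner_commute: "cinner x y = cnj (cinner y x)"
    and cinner_add_left: "cinner (x + y) z = cinner x z + cinner y z"
    and cinner_scaleC_left: "cinner (c *\<^sub>C x) y = c * cinner x y"
    and cinner_ge_zero: "0 \<le> Re (cinner x x)"
    and cinner_eq_zero_iff: "cinner x x = 0 \<longleftrightarrow> x = 0"
    and norm_eq_sqrt_cinner: "norm x = sqrt (Re (cinner x x))"

class complex_hilbert_space = complex_inner + complete_space

lemma vector_space_scaleC: "vector_space (scaleC :: complex \<Rightarrow> 'a \<Rightarrow> 'a::complex_inner)"
  by unfold_locales
    (rule scaleC_add_right scaleC_add_left scaleC_scaleC scaleC_one)+

text \<open>The dimension is the algebraic dimension over the complex numbers.\<close>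

definition infinite_dimensional :: "'h::complex_inner itself \<Rightarrow> bool" where
  "infinite_dimensional _ \<longleftrightarrow>
    \<not> (\<exists>B::'h set. finite B \<and> module.span scaleC B = UNIV)"

definition weakly_measurable :: "'a measure \<Rightarrow> ('a \<Rightarrow> 'h::complex_inner) \<Rightarrow> bool" where
  "weakly_measurable M F \<longleftrightarrow> (\<forall>f. (\<lambda>\<omega>. cinner f (F \<omega>)) \<in> borel_measurable M)"

text \<open>
  The integral is the Lebesgue integral with values in \<^typ>\<open>ennreal\<close>, so that the upper bound
  asserts finiteness (a Bochner integral would be 0 on functions that are not integrable).
\<close>

definition frame_bounds ::
    "'a measure \<Rightarrow> ('a \<Rightarrow> 'h::complex_inner) \<Rightarrow> real \<Rightarrow> real \<Rightarrow> bool" where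
  "frame_bounds M F A B \<longleftrightarrow>
    (\<forall>f. ennreal (A * (norm f)\<^sup>2) \<le> (\<integral>\<^sup>+ \<omega>. ennreal ((cmod (cinner f (F \<omega>)))\<^sup>2) \<partial>M) \<and>
         (\<integral>\<^sup>+ \<omega>. ennreal ((cmod (cinner f (F \<omega>)))\<^sup>2) \<partial>M) \<le> ennreal (B * (norm f)\<^sup>2))"

definition continuous_frame ::
    "'a measure \<Rightarrow> ('a \<Rightarrow> 'h::complex_hilbert_space) \<Rightarrow> bool" where
  "continuous_frame M F \<longleftrightarrow> weakly_measurable M F \<and> (\<exists>A>0. \<exists>B>0. frame_bounds M F A B)"

definition continuous_parseval_frame ::
    "'a measure \<Rightarrow> ('a \<Rightarrow> 'h::complex_hilbert_space) \<Rightarrow> bool" where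
  "continuous_parseval_frame M F \<longleftrightarrow> continuous_frame M F \<and> frame_bounds M F 1 1"

end

theory Submission
  imports Defs
begin

text \<open>
  The frame is a step function. A \<open>\<sigma>\<close>-finite space of infinite measure splits into
  countably many measurable pieces \<open>\<Omega>\<^sub>0, \<Omega>\<^sub>1, \<dots>\<close> of finite and positive measure
  (lemma \<open>sigma_finite_infinite_partition\<close>). A separable inner product space has a
  sequence \<open>e\<^sub>0, e\<^sub>1, \<dots>\<close> with \<open>\<Sum>k. \<bar>\<langle>f, e\<^sub>k\<rangle>\<bar>\<^sup>2 = \<parallel>f\<parallel>\<^sup>2\<close> for all \<open>f\<close>
  (lemma \<open>separable_imp_parseval_sequence\<close>). Give \<open>F\<close> the constant value
  \<open>e\<^sub>k / sqrt (\<mu> \<Omega>\<^sub>k)\<close> on \<open>\<Omega>\<^sub>k\<close>: the factor cancels the measure of the piece, so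
  that the integral of \<open>\<bar>\<langle>f, F \<omega>\<rangle>\<bar>\<^sup>2\<close> is \<open>\<Sum>k. \<bar>\<langle>f, e\<^sub>k\<rangle>\<bar>\<^sup>2 = \<parallel>f\<parallel>\<^sup>2\<close>.

  The sequence comes from the Gram-Schmidt process for a dense sequence \<open>d\<close>, in its
  modified form: starting from the identity, the operator \<open>R\<^sub>n\<close> is updated by subtracting the
  component along the normalised vector \<open>e\<^sub>n = R\<^sub>n d\<^sub>n / \<parallel>R\<^sub>n d\<^sub>n\<parallel>\<close>, which is taken to
  be \<open>0\<close> if \<open>R\<^sub>n d\<^sub>n = 0\<close>. So \<open>R\<^sub>n\<close> is the orthogonal projection onto
  the complement of \<open>d\<^sub>0, \<dots>, d\<^sub>n\<^sub>-\<^sub>1\<close>, and Pythagoras gives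
  \<open>\<Sum>k<n. \<bar>\<langle>f, e\<^sub>k\<rangle>\<bar>\<^sup>2 = \<parallel>f\<parallel>\<^sup>2 - \<parallel>R\<^sub>n f\<parallel>\<^sup>2\<close>. Since \<open>R\<^sub>n\<close> is a linear contraction
  that kills \<open>d\<^sub>m\<close> for \<open>m < n\<close>, eventually \<open>\<parallel>R\<^sub>n f\<parallel> \<le> \<parallel>f - d\<^sub>m\<parallel>\<close>, and density makes
  this arbitrarily small.
\<close>

section \<open>Complex inner products\<close>

lemma cinner_zero_left [simp]: "cinner 0 y = 0"
  using cinner_add_left[of 0 0 y] by simp

lemma cinner_zero_right [simp]: "cinner x 0 = 0"
  using cinner_commute[of x 0] by simp

lemma cinner_diff_left: "cinner (x - y) z = cinner x z - cinner y z"
  using cinner_add_left[of "x - y" y z] by simp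

lemma cinner_diff_right: "cinner z (x - y) = cinner z x - cinner z y"
  by (metis cinner_commute cinner_diff_left complex_cnj_diff)

lemma cinner_scaleC_right: "cinner x (c *\<^sub>C y) = cnj c * cinner x y"
  by (metis cinner_commute cinner_scaleC_left complex_cnj_mult)

lemma cinner_scaleR_left: "cinner (r *\<^sub>R x) y = complex_of_real r * cinner x y"
  by (metis cinner_scaleC_left scaleC_of_real)

lemma cinner_scaleR_right: "cinner x (r *\<^sub>R y) = complex_of_real r * cinner x y"
  by (metis cinner_scaleC_right scaleC_of_real complex_cnj_complex_of_real)

lemma scaleC_zero_left [simp]: "0 *\<^sub>C x = 0"
  using scaleC_of_real[of 0 x] by simp

lemma scaleC_diff_left: "(c - d) *\<^sub>C x = c *\<^sub>C x - d *\<^sub>C x"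
  using scaleC_add_left[of "c - d" d x] by (simp add: algebra_simps)

lemma cinner_self: "cinner x x = complex_of_real ((norm x)\<^sup>2)"
proof -
  have "Im (cinner x x) = 0"
    using arg_cong[OF cinner_commute[of x x], of Im] by simp
  then show ?thesis
    by (simp add: complex_eq_iff norm_eq_sqrt_cinner cinner_ge_zero)
qed

lemma cinner_sgn_self: "x \<noteq> 0 \<Longrightarrow> cinner (sgn x) (sgn x) = 1"
  by (simp add: cinner_self norm_sgn)

lemma norm_diff_component_sq:
  assumes "cinner e e = 1"
  shows "(norm (x - cinner x e *\<^sub>C e))\<^sup>2 = (norm x)\<^sup>2 - (cmod (cinner x e))\<^sup>2"
proof -
  have "complex_of_real ((norm (x - cinner x e *\<^sub>C e))\<^sup>2)
      = cinner x x - cinner x e * cnj (cinner x e)"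
    unfolding cinner_self[symmetric] using assms cinner_commute[of e x]
    by (simp add: cinner_diff_left cinner_diff_right cinner_scaleC_left cinner_scaleC_right)
  also have "\<dots> = complex_of_real ((norm x)\<^sup>2 - (cmod (cinner x e))\<^sup>2)"
    by (simp only: cinner_self complex_norm_square of_real_diff)
  finally show ?thesis
    using of_real_eq_iff by blast
qed

section \<open>Gram-Schmidt residuals and Parseval sequences\<close>

text \<open>
  The recursion runs over the operators instead of the vectors, which keeps finite sums out
  of the proofs. Since \<open>sgn 0 = 0\<close>, a \<open>d\<^sub>n\<close> that depends linearly on its predecessors
  leaves the operator as it is.
\<close>

primrec gs_residual :: "(nat \<Rightarrow> 'h::complex_inner) \<Rightarrow> nat \<Rightarrow> 'h \<Rightarrow> 'h" where
  "gs_residual d 0 x = x"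
| "gs_residual d (Suc n) x =
     gs_residual d n x
       - cinner (gs_residual d n x) (sgn (gs_residual d n (d n))) *\<^sub>C sgn (gs_residual d n (d n))"

definition gs_vector :: "(nat \<Rightarrow> 'h::complex_inner) \<Rightarrow> nat \<Rightarrow> 'h" where
  "gs_vector d n = sgn (gs_residual d n (d n))"

lemma gs_residual_Suc:
  "gs_residual d (Suc n) x =
     gs_residual d n x - cinner (gs_residual d n x) (gs_vector d n) *\<^sub>C gs_vector d n"
  by (simp add: gs_vector_def)

declare gs_residual.simps(2) [simp del]

lemma gs_vector_cases: "gs_vector d n = 0 \<or> cinner (gs_vector d n) (gs_vector d n) = 1"
  unfolding gs_vector_def using cinner_sgn_self by (metis sgn_zero)

lemma gs_residual_diff: "gs_residual d n (x - y) = gs_residual d n x - gs_residual d n y"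
  by (induction n) (simp_all add: gs_residual_Suc cinner_diff_left scaleC_diff_left)

lemma gs_residual_orthogonal:
  "k < n \<Longrightarrow> cinner (gs_residual d n x) (gs_vector d k) = 0"
proof (induction n arbitrary: x)
  case (Suc n)
  show ?case
  proof (cases "k = n")
    case True
    then show ?thesis
      using gs_vector_cases[of d n]
      by (auto simp: gs_residual_Suc cinner_diff_left cinner_scaleC_left)
  next
    case False
    then have "k < n"
      using Suc.prems by simp
    moreover have "cinner (gs_vector d n) (gs_vector d k) = 0"
      using Suc.IH[OF \<open>k < n\<close>, of "d n"]
      by (simp add: gs_vector_def[of d n] sgn_div_norm cinner_scaleR_left)
    ultimately show ?thesis
      by (simp add: gs_residual_Suc cinner_diff_left cinner_scaleC_left Suc.IH)
  qed
qed simp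

text \<open>
  What has been subtracted from \<open>x\<close> before step \<open>n\<close> is a combination of \<open>e\<^sub>0, \<dots>, e\<^sub>n\<^sub>-\<^sub>1\<close>,
  all orthogonal to \<open>e\<^sub>n\<close>. So the coefficients of the process are those of \<open>x\<close> itself.
\<close>

lemma cinner_gs_residual:
  "cinner (gs_residual d n x) (gs_vector d n) = cinner x (gs_vector d n)"
proof -
  have orth: "cinner (gs_vector d k) (gs_vector d n) = 0" if "k < n" for k
  proof -
    have "cinner (gs_vector d n) (gs_vector d k) = 0"
      using gs_residual_orthogonal[OF that, of d "d n"]
      by (simp add: gs_vector_def[of d n] sgn_div_norm cinner_scaleR_left)
    then show ?thesis
      using cinner_commute[of "gs_vector d k" "gs_vector d n"] by simp
  qed
  have "m \<le> n \<Longrightarrow> cinner (gs_residual d m x) (gs_vector d n) = cinner x (gs_vector d n)" for m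
    by (induction m)
      (simp_all add: gs_residual_Suc cinner_diff_left cinner_scaleC_left orth)
  then show ?thesis
    by simp
qed

lemma norm_gs_residual_sq:
  "(norm (gs_residual d n x))\<^sup>2 = (norm x)\<^sup>2 - (\<Sum>k<n. (cmod (cinner x (gs_vector d k)))\<^sup>2)"
proof (induction n)
  case (Suc n)
  have "(norm (gs_residual d (Suc n) x))\<^sup>2
      = (norm (gs_residual d n x))\<^sup>2 - (cmod (cinner x (gs_vector d n)))\<^sup>2"
    using gs_vector_cases[of d n] norm_diff_component_sq[of "gs_vector d n" "gs_residual d n x"]
    by (auto simp: gs_residual_Suc cinner_gs_residual)
  then show ?case
    using Suc.IH by simp
qed simp

lemma norm_gs_residual_le: "norm (gs_residual d n x) \<le> norm x"
proof (rule power2_le_imp_le)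
  show "(norm (gs_residual d n x))\<^sup>2 \<le> (norm x)\<^sup>2"
    unfolding norm_gs_residual_sq by (simp add: sum_nonneg)
qed simp

lemma gs_residual_eq_0: "m < n \<Longrightarrow> gs_residual d n (d m) = 0"
proof (induction n)
  case (Suc n)
  show ?case
  proof (cases "m = n")
    case True
    let ?r = "gs_residual d n (d n)"
    have "cinner ?r (sgn ?r) = complex_of_real (norm ?r)"
      by (cases "?r = 0")
        (simp_all add: sgn_div_norm cinner_scaleR_right cinner_self power2_eq_square)
    then have "cinner ?r (sgn ?r) *\<^sub>C sgn ?r = ?r"
      by (cases "?r = 0") (simp_all add: scaleC_of_real sgn_div_norm)
    then show ?thesis
      using True by (simp add: gs_residual_Suc gs_vector_def)
  next
    case False
    then show ?thesis
      using Suc by (simp add: gs_residual_Suc)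
  qed
qed simp

lemma gs_vector_parseval:
  fixes d :: "nat \<Rightarrow> 'h::complex_inner"
  assumes dense: "closure (range d) = UNIV"
  shows "(\<lambda>k. (cmod (cinner f (gs_vector d k)))\<^sup>2) sums (norm f)\<^sup>2"
proof -
  have "(\<lambda>n. gs_residual d n f) \<longlonglongrightarrow> 0"
  proof (rule LIMSEQ_I)
    fix \<epsilon> :: real
    assume "\<epsilon> > 0"
    have "f \<in> closure (range d)"
      using dense by simp
    then obtain m where m: "dist (d m) f < \<epsilon>"
      using \<open>\<epsilon> > 0\<close> unfolding closure_approachable by blast
    have "norm (gs_residual d n f - 0) < \<epsilon>" if "n \<ge> Suc m" for n
    proof -
      have "gs_residual d n f = gs_residual d n (f - d m)"
        using that by (simp add: gs_residual_diff gs_residual_eq_0)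
      also have "norm \<dots> \<le> norm (f - d m)"
        by (rule norm_gs_residual_le)
      also have "\<dots> < \<epsilon>"
        using m by (simp add: dist_norm norm_minus_commute)
      finally show ?thesis
        by simp
    qed
    then show "\<exists>N. \<forall>n\<ge>N. norm (gs_residual d n f - 0) < \<epsilon>"
      by blast
  qed
  then have "(\<lambda>n. (norm f)\<^sup>2 - (norm (gs_residual d n f))\<^sup>2) \<longlonglongrightarrow> (norm f)\<^sup>2 - (norm (0::'h))\<^sup>2"
    by (intro tendsto_intros)
  then show ?thesis
    by (simp add: sums_def norm_gs_residual_sq)
qed

lemma separable_imp_parseval_sequence:
  assumes "separable_space (euclidean :: 'h::complex_inner topology)"
  shows "\<exists>e :: nat \<Rightarrow> 'h. \<forall>f. (\<lambda>k. (cmod (cinner f (e k)))\<^sup>2) sums (norm f)\<^sup>2"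
proof -
  obtain U :: "'h set" where U: "countable U" "closure U = UNIV"
    using assms unfolding separable_space_def by auto
  then have "U \<noteq> {}"
    by auto
  then have "range (from_nat_into U) = U"
    using U(1) by (rule range_from_nat_into)
  then show ?thesis
    using gs_vector_parseval[of "from_nat_into U"] U(2) by auto
qed

section \<open>Partitions of measure spaces of infinite measure\<close>

text \<open>
  The pieces are the fibres of a measurable map to the natural numbers. An exhaustion by sets
  of finite measure has unbounded measures, so a subsequence of it has strictly increasing
  measures; the successive differences along that subsequence are then not null sets.
\<close>

lemma sigma_finite_infinite_partition:
  assumes "sigma_finite_measure M" and inf: "emeasure M (space M) = \<infinity>"
  shows "\<exists>N :: 'a \<Rightarrow> nat. N \<in> measurable M (count_space UNIV) \<and>
           (\<forall>k. 0 < emeasure M (N -` {k} \<inter> space M) \<and> emeasure M (N -` {k} \<inter> space M) < \<infinity>)"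
proof -
  interpret sigma_finite_measure M
    by fact
  obtain A :: "nat \<Rightarrow> 'a set" where A: "range A \<subseteq> sets M" "(\<Union>i. A i) = space M"
    "\<And>i. emeasure M (A i) \<noteq> \<infinity>" "incseq A"
    using sigma_finite_incseq by metis
  have "(\<lambda>i. emeasure M (A i)) \<longlonglongrightarrow> \<infinity>"
    using Lim_emeasure_incseq[OF A(1,4)] A(2) inf by simp
  then have large: "\<exists>j. c < emeasure M (A j) \<and> i < j" if "c < \<infinity>" for c i
  proof -
    have "\<forall>\<^sub>F j in sequentially. c < emeasure M (A j)"
      using order_tendstoD(1)[OF \<open>(\<lambda>i. emeasure M (A i)) \<longlonglongrightarrow> \<infinity>\<close> that] .
    then have "\<forall>\<^sub>F j in sequentially. c < emeasure M (A j) \<and> i < j"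
      using eventually_gt_at_top[of i] by eventually_elim simp
    then show ?thesis
      using eventually_happens'[OF sequentially_bot] by blast
  qed
  have "\<exists>s :: nat \<Rightarrow> nat. \<forall>n. 0 < emeasure M (A (s n)) \<and>
          (emeasure M (A (s n)) < emeasure M (A (s (Suc n))) \<and> s n < s (Suc n))"
  proof (rule dependent_nat_choice)
    show "\<exists>i. 0 < emeasure M (A i)"
      using large[of 0 0] by auto
    show "\<exists>j. 0 < emeasure M (A j) \<and> emeasure M (A i) < emeasure M (A j) \<and> i < j"
      if "0 < emeasure M (A i)" for i n
    proof -
      have "emeasure M (A i) < \<infinity>"
        using A(3)[of i] by (simp add: top.not_eq_extremum)
      then obtain j where "emeasure M (A i) < emeasure M (A j)" "i < j"
        using large by blast
      then show ?thesis
        using that by (intro exI[of _ j]) (auto intro: order.strict_trans)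
    qed
  qed
  then obtain s :: "nat \<Rightarrow> nat" where s: "\<And>n. 0 < emeasure M (A (s n))"
    "\<And>n. emeasure M (A (s n)) < emeasure M (A (s (Suc n)))" "\<And>n. s n < s (Suc n)"
    by blast
  define B where "B n = A (s n)" for n
  have "strict_mono s"
    using s(3) by (simp add: strict_mono_Suc_iff)
  have B_sets [measurable]: "B n \<in> sets M" for n
    using A(1) by (auto simp: B_def)
  have B_finite: "emeasure M (B n) < \<infinity>" for n
    using A(3)[of "s n"] by (simp add: B_def top.not_eq_extremum)
  have B_mono: "B m \<subseteq> B n" if "m \<le> n" for m n
    unfolding B_def using that strict_mono_less_eq[OF \<open>strict_mono s\<close>]
    by (intro incseqD[OF A(4)]) simp
  have B_cover: "\<exists>n. x \<in> B n" if "x \<in> space M" for x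
  proof -
    obtain i where "x \<in> A i"
      using A(2) \<open>x \<in> space M\<close> by blast
    moreover have "A i \<subseteq> A (s i)"
      by (intro incseqD[OF A(4)] strict_mono_imp_increasing \<open>strict_mono s\<close>)
    ultimately show ?thesis
      unfolding B_def by (intro exI[of _ i]) (rule subsetD)
  qed
  define N where "N x = (LEAST n. x \<in> B n)" for x
  have N_le: "N x \<le> n \<longleftrightarrow> x \<in> B n" if "x \<in> space M" for x n
  proof
    show "x \<in> B n" if "N x \<le> n"
      using LeastI_ex[OF B_cover[OF \<open>x \<in> space M\<close>]] B_mono[OF that]
      unfolding N_def by (rule subsetD[rotated])
    show "N x \<le> n" if "x \<in> B n"
      unfolding N_def using that by (rule Least_le)
  qed
  have fibre_0: "N -` {0} \<inter> space M = B 0"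
    using N_le[of _ 0] sets.sets_into_space[OF B_sets] by auto
  have fibre_Suc: "N -` {Suc n} \<inter> space M = B (Suc n) - B n" for n
  proof -
    have "N x = Suc n \<longleftrightarrow> N x \<le> Suc n \<and> \<not> N x \<le> n" for x
      by auto
    then show ?thesis
      using N_le sets.sets_into_space[OF B_sets[of "Suc n"]] by auto
  qed
  have fibre_sets: "N -` {k} \<inter> space M \<in> sets M" for k
    by (cases k) (simp_all add: fibre_0 fibre_Suc)
  have "N \<in> measurable M (count_space UNIV)"
    using fibre_sets by (simp add: measurable_count_space_eq2_countable)
  moreover have "0 < emeasure M (N -` {k} \<inter> space M) \<and> emeasure M (N -` {k} \<inter> space M) < \<infinity>" for k
  proof (cases k)
    case 0
    then show ?thesis
      using s(1)[of 0] B_finite[of 0] by (simp add: fibre_0 B_def)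
  next
    case (Suc n)
    have "emeasure M (B (Suc n) - B n) = emeasure M (B (Suc n)) - emeasure M (B n)"
      using B_finite[of n] B_mono[of n "Suc n"] by (intro emeasure_Diff) (auto simp: B_sets)
    moreover have "0 < emeasure M (B (Suc n)) - emeasure M (B n)"
      using s(2)[of n] by (simp add: B_def diff_gr0_ennreal)
    moreover have "emeasure M (B (Suc n) - B n) < \<infinity>"
      using B_finite[of "Suc n"] by (rule le_less_trans[rotated]) (auto intro: emeasure_mono)
    ultimately show ?thesis
      using Suc by (simp add: fibre_Suc)
  qed
  ultimately show ?thesis
    by blast
qed

lemma nn_integral_nat_fibres:
  fixes N :: "'a \<Rightarrow> nat" and h :: "nat \<Rightarrow> ennreal"
  assumes N [measurable]: "N \<in> measurable M (count_space UNIV)"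
  shows "(\<integral>\<^sup>+ x. h (N x) \<partial>M) = (\<Sum>k. h k * emeasure M (N -` {k} \<inter> space M))"
proof -
  have "(\<integral>\<^sup>+ x. h (N x) \<partial>M) = (\<integral>\<^sup>+ x. (\<Sum>k. h k * indicator (N -` {k} \<inter> space M) x) \<partial>M)"
  proof (rule nn_integral_cong)
    fix x
    assume "x \<in> space M"
    then have "(\<lambda>k. h k * indicator (N -` {k} \<inter> space M) x) = (\<lambda>k. if k = N x then h k else 0)"
      by (auto simp: indicator_def)
    then show "h (N x) = (\<Sum>k. h k * indicator (N -` {k} \<inter> space M) x)"
      using sums_unique[OF sums_single[of "N x" h]] by simp
  qed
  also have "\<dots> = (\<Sum>k. \<integral>\<^sup>+ x. h k * indicator (N -` {k} \<inter> space M) x \<partial>M)"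
    using measurable_sets[OF N]
    by (intro nn_integral_suminf borel_measurable_times_ennreal borel_measurable_indicator) auto
  also have "\<dots> = (\<Sum>k. h k * emeasure M (N -` {k} \<inter> space M))"
    using measurable_sets[OF N] by (simp add: nn_integral_cmult_indicator)
  finally show ?thesis .
qed

section \<open>Continuous Parseval frames\<close>

theorem proposition3p1:
  fixes M :: "'a measure"
  assumes "sigma_finite_measure M"
    and "emeasure M (space M) = \<infinity>"
    and "separable_space (euclidean :: 'h::complex_hilbert_space topology)"
    and "infinite_dimensional TYPE('h)"
  shows "\<exists>F :: 'a \<Rightarrow> 'h. continuous_parseval_frame M F"
proof -
  obtain e :: "nat \<Rightarrow> 'h"
    where e: "\<And>f. (\<lambda>k. (cmod (cinner f (e k)))\<^sup>2) sums (norm f)\<^sup>2"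
    using separable_imp_parseval_sequence[OF assms(3)] by blast
  obtain N :: "'a \<Rightarrow> nat" where N [measurable]: "N \<in> measurable M (count_space UNIV)"
    and fibre: "\<And>k. 0 < emeasure M (N -` {k} \<inter> space M)"
      "\<And>k. emeasure M (N -` {k} \<inter> space M) < \<infinity>"
    using sigma_finite_infinite_partition[OF assms(1,2)] by blast
  define w where "w k = measure M (N -` {k} \<inter> space M)" for k
  have w: "emeasure M (N -` {k} \<inter> space M) = ennreal (w k)" for k
    unfolding w_def using fibre(2)[of k] by (intro emeasure_eq_ennreal_measure) auto
  have w_pos: "w k > 0" for k
    using fibre(1)[of k] by (simp add: w)
  define F where "F \<omega> = (1 / sqrt (w (N \<omega>))) *\<^sub>R e (N \<omega>)" for \<omega>
  have "weakly_measurable M F"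
    unfolding weakly_measurable_def F_def by measurable
  moreover have "(\<integral>\<^sup>+ \<omega>. ennreal ((cmod (cinner f (F \<omega>)))\<^sup>2) \<partial>M) = ennreal ((norm f)\<^sup>2)" for f
  proof -
    define h where "h k = ennreal ((cmod (cinner f ((1 / sqrt (w k)) *\<^sub>R e k)))\<^sup>2)" for k
    have h: "h k * ennreal (w k) = ennreal ((cmod (cinner f (e k)))\<^sup>2)" for k
      unfolding h_def using w_pos[of k]
      by (simp add: cinner_scaleR_right norm_mult norm_divide power_mult_distrib power_divide
          flip: ennreal_mult)
    have "(\<integral>\<^sup>+ \<omega>. ennreal ((cmod (cinner f (F \<omega>)))\<^sup>2) \<partial>M) = (\<integral>\<^sup>+ \<omega>. h (N \<omega>) \<partial>M)"
      by (simp add: F_def h_def)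
    also have "\<dots> = (\<Sum>k. ennreal ((cmod (cinner f (e k)))\<^sup>2))"
      by (simp add: nn_integral_nat_fibres[OF N] w h)
    also have "\<dots> = ennreal ((norm f)\<^sup>2)"
      using e[of f] by (intro suminf_ennreal_eq) simp_all
    finally show ?thesis .
  qed
  ultimately have "weakly_measurable M F" "frame_bounds M F 1 1"
    by (simp_all add: frame_bounds_def)
  then show ?thesis
    unfolding continuous_parseval_frame_def continuous_frame_def using zero_less_one by blast
qed

end
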